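(* Consider the problem of minimizing $J(x(\cdot))=\int_{t_0}^{t_1}L(t,x(t),\dot x(t))\,dt$ over $x(\cdot)\in KC^1(I,\mathbb R^n)$ with $x(t_0)=x_0$, $x(t_1)=x_1$. Suppose $L$ is continuously differentiable in the totality of variables and triply continuously differentiable with respect to the variable $\dot x$. Let the admissible function $\bar x(\cdot)$ be a weak local minimum in this problem, let $\{\tau\}\subset(t_0,t_1)$ be the set of its angular points, and let $\eta\in\mathbb R^n$, $\eta\ne0$. Then: If $\theta\in(t_0,t_1)\setminus\{\tau\}$ and $\eta^T\bar L_{\dot x\dot x}(\theta)\eta=0$, then $\big(\eta^T\bar L_{\dot x\dot x}(\theta)\eta\big)_{\dot x}^T\eta=0$. If $\theta\in\{t_0\}\cup\{\tau\}$ and $\eta^T\bar L_{\dot x\dot x}(\theta+)\eta=0$, then $\big(\eta^T\bar L_{\dot x\dot x}(\theta+)\eta\big)_{\dot x}^T\eta=0$. If $\theta\in\{\tau\}\cup\{t_1\}$ and $\eta^T\bar L_{\dot x\dot x}(\theta-)\eta=0$, then $\big(\eta^T\bar L_{\dot x\dot x}(\theta-)\eta\big)_{\dot x}^T\eta=0$.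
   Context: Setting. $(a,b)\subset\mathbb R$ is an interval, $I:=[t_0,t_1]\subset(a,b)$ with $t_0<t_1$, $x_0,x_1\in\mathbb R^n$, and $L=L(t,x,\dot x):(a,b)\times\mathbb R^n\times\mathbb R^n\to\mathbb R$; $L_{\dot x\dot x}$ is the Hessian of $L$ in its third argument; $T$ denotes transposition. $KC^1(I,\mathbb R^n)$ is the set of piecewise-smooth functions: continuous functions $x:I\to\mathbb R^n$ whose derivative is continuous on $I$ except at finitely many points of $(t_0,t_1)$ (angular points), where $\dot x$ has discontinuities of the first kind (finite one-sided limits); at $t_0$ and $t_1$ the right, respectively left, values of $\dot x$ are finite. A function $x(\cdot)\in KC^1(I,\mathbb R^n)$ with $x(t_0)=x_0$, $x(t_1)=x_1$ is called admissible. An admissible $\bar x(\cdot)$ is a weak local minimum if there is $\hat\delta>0$ such that $J(x(\cdot))\ge J(\bar x(\cdot))$ for all admissible $x(\cdot)$ with $\max\{\|x(\cdot)-\bar x(\cdot)\|_{C(I,\mathbb R^n)},\|\dot x(\cdot)-\dot{\bar x}(\cdot)\|_{L_\infty(I,\mathbb R^n)}\}\le\hat\delta$. Notation: $\bar L_{\dot x\dot x}(t)=L_{\dot x\dot x}(t,\bar x(t),\dot{\bar x}(t))$; $\big(\eta^T\bar L_{\dot x\dot x}(t)\eta\big)_{\dot x}$ is the gradient with respect to $\dot x$ of the function $\eta^TL_{\dot x\dot x}(t,x,\dot x)\eta$, evaluated at $x=\bar x(t)$, $\dot x=\dot{\bar x}(t)$. $F(\theta+)$ (resp. $F(\theta-)$)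 is the right-hand (left-hand) limit of $F$ at $\theta$; for the functions above it is obtained by using $\dot{\bar x}(\theta+)$ (resp. $\dot{\bar x}(\theta-)$) in place of $\dot{\bar x}(\theta)$. *)

theory Defs
  imports "HOL-Analysis.Analysis" "HOL-Probability.Essential_Supremum"
begin

text \<open>At the end points of the interval this is the one-sided derivative. Where the curve is not
  differentiable the value is unspecified; under the hypotheses used below that happens only at
  finitely many points.\<close>

definition velocity :: "real \<Rightarrow> real \<Rightarrow> (real \<Rightarrow> real^'n) \<Rightarrow> real \<Rightarrow> real^'n" where
  "velocity t0 t1 x t = vector_derivative x (at t within {t0..t1})"

definition angular_points :: "real \<Rightarrow> real \<Rightarrow> (real \<Rightarrow> real^'n) \<Rightarrow> real set" where
  "angular_points t0 t1 x =
     {t \<in> {t0<..<t1}. \<not> (x differentiable (at t) \<and> isCont (velocity t0 t1 x) t)}"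

definition KC1 :: "real \<Rightarrow> real \<Rightarrow> (real \<Rightarrow> real^'n) set" where
  "KC1 t0 t1 = {x.
     continuous_on {t0..t1} x \<and>
     finite (angular_points t0 t1 x) \<and>
     (\<forall>t \<in> angular_points t0 t1 x.
        (\<exists>l. (velocity t0 t1 x \<longlongrightarrow> l) (at_left t)) \<and>
        (\<exists>l. (velocity t0 t1 x \<longlongrightarrow> l) (at_right t))) \<and>
     (\<forall>t \<in> {t0, t1}.
        x differentiable (at t within {t0..t1}) \<and>
        continuous (at t within {t0..t1}) (velocity t0 t1 x))}"

definition admissible ::
  "real \<Rightarrow> real \<Rightarrow> real^'n \<Rightarrow> real^'n \<Rightarrow> (real \<Rightarrow> real^'n) \<Rightarrow> bool" where
  "admissible t0 t1 x0 x1 x \<longleftrightarrow> x \<in> KC1 t0 t1 \<and> x t0 = x0 \<and> x t1 = x1"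

definition J :: "(real \<Rightarrow> real^'n \<Rightarrow> real^'n \<Rightarrow> real) \<Rightarrow> real \<Rightarrow> real \<Rightarrow> (real \<Rightarrow> real^'n) \<Rightarrow> real" where
  "J L t0 t1 x = integral {t0..t1} (\<lambda>t. L t (x t) (velocity t0 t1 x t))"

definition C_norm :: "real \<Rightarrow> real \<Rightarrow> (real \<Rightarrow> real^'n) \<Rightarrow> real" where
  "C_norm t0 t1 y = (SUP t\<in>{t0..t1}. norm (y t))"

definition Linf_norm :: "real \<Rightarrow> real \<Rightarrow> (real \<Rightarrow> real^'n) \<Rightarrow> ereal" where
  "Linf_norm t0 t1 v = esssup (lebesgue_on {t0..t1}) (\<lambda>t. ereal (norm (v t)))"

definition weak_local_minimum ::
  "(real \<Rightarrow> real^'n \<Rightarrow> real^'n \<Rightarrow> real) \<Rightarrow> real \<Rightarrow> real \<Rightarrow> real^'n \<Rightarrow> real^'n \<Rightarrow> (real \<Rightarrow> real^'n) \<Rightarrow> bool"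
  where
  "weak_local_minimum L t0 t1 x0 x1 xb \<longleftrightarrow>
     admissible t0 t1 x0 x1 xb \<and>
     (\<exists>\<delta>>0. \<forall>x. admissible t0 t1 x0 x1 x \<longrightarrow>
        max (ereal (C_norm t0 t1 (\<lambda>t. x t - xb t)))
            (Linf_norm t0 t1 (\<lambda>t. velocity t0 t1 x t - velocity t0 t1 xb t)) \<le> ereal \<delta> \<longrightarrow>
        J L t0 t1 x \<ge> J L t0 t1 xb)"

definition C1_total ::
  "(real \<times> (real^'n) \<times> (real^'n)) set \<Rightarrow> (real \<Rightarrow> real^'n \<Rightarrow> real^'n \<Rightarrow> real) \<Rightarrow> bool" where
  "C1_total U L \<longleftrightarrow>
     (\<exists>D :: real \<times> (real^'n) \<times> (real^'n) \<Rightarrow> (real \<times> (real^'n) \<times> (real^'n)) \<Rightarrow>\<^sub>L real.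
        continuous_on U D \<and>
        (\<forall>p\<in>U. ((\<lambda>(t, x, v). L t x v) has_derivative blinfun_apply (D p)) (at p)))"

text \<open>The derivatives of order one, two and three are taken in the last argument only, but their
  continuity is required jointly in all arguments.\<close>

definition C3_last ::
  "(real \<times> (real^'n) \<times> (real^'n)) set \<Rightarrow> (real \<Rightarrow> real^'n \<Rightarrow> real^'n \<Rightarrow> real) \<Rightarrow> bool" where
  "C3_last U L \<longleftrightarrow>
     (\<exists>(D1 :: real \<times> (real^'n) \<times> (real^'n) \<Rightarrow> (real^'n) \<Rightarrow>\<^sub>L real)
       (D2 :: real \<times> (real^'n) \<times> (real^'n) \<Rightarrow> (real^'n) \<Rightarrow>\<^sub>L (real^'n) \<Rightarrow>\<^sub>L real)
       (D3 :: real \<times> (real^'n) \<times> (real^'n) \<Rightarrow> (real^'n) \<Rightarrow>\<^sub>L (real^'n) \<Rightarrow>\<^sub>L (real^'n) \<Rightarrow>\<^sub>L real).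
        continuous_on U D1 \<and> continuous_on U D2 \<and> continuous_on U D3 \<and>
        (\<forall>(t, x, v)\<in>U.
           (L t x has_derivative blinfun_apply (D1 (t, x, v))) (at v) \<and>
           ((\<lambda>w. D1 (t, x, w)) has_derivative blinfun_apply (D2 (t, x, v))) (at v) \<and>
           ((\<lambda>w. D2 (t, x, w)) has_derivative blinfun_apply (D3 (t, x, v))) (at v)))"

definition gradient :: "(real^'n \<Rightarrow> real) \<Rightarrow> real^'n \<Rightarrow> real^'n" where
  "gradient f v = (THE g. GDERIV f v :> g)"

lemma gradient_eqI: "GDERIV f v :> g \<Longrightarrow> gradient f v = g"
  unfolding gradient_def
  by (rule the_equality, assumption)
     (metis gderiv_def has_derivative_unique inner_commute vector_eq_ldot)

definition hessian :: "(real^'n \<Rightarrow> real) \<Rightarrow> real^'n \<Rightarrow> real^'n^'n" where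
  "hessian f v = jacobian (gradient f) (at v)"

definition Lbar_vv ::
  "(real \<Rightarrow> real^'n \<Rightarrow> real^'n \<Rightarrow> real) \<Rightarrow> real \<Rightarrow> real \<Rightarrow> (real \<Rightarrow> real^'n) \<Rightarrow> real \<Rightarrow> real^'n^'n" where
  "Lbar_vv L t0 t1 xb t = hessian (L t (xb t)) (velocity t0 t1 xb t)"

definition grad_quad_Lbar_vv ::
  "(real \<Rightarrow> real^'n \<Rightarrow> real^'n \<Rightarrow> real) \<Rightarrow> real \<Rightarrow> real \<Rightarrow> (real \<Rightarrow> real^'n) \<Rightarrow> real^'n \<Rightarrow> real \<Rightarrow> real^'n"
  where
  "grad_quad_Lbar_vv L t0 t1 xb \<eta> t =
     gradient (\<lambda>v. \<eta> \<bullet> (hessian (L t (xb t)) v *v \<eta>)) (velocity t0 t1 xb t)"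

definition right_lim :: "(real \<Rightarrow> 'b::t2_space) \<Rightarrow> real \<Rightarrow> 'b" where
  "right_lim F \<theta> = Lim (at_right \<theta>) F"

definition left_lim :: "(real \<Rightarrow> 'b::t2_space) \<Rightarrow> real \<Rightarrow> 'b" where
  "left_lim F \<theta> = Lim (at_left \<theta>) F"

end

theory Submission
  imports Defs
begin

text \<open>Perturb the minimizer near a regular point by a saw-tooth with slope \<open>w\<close> on
  an interval of length \<open>\<epsilon>\<close> and slope \<open>-w/2\<close> on the next interval of length
  \<open>2\<epsilon>\<close>. Dividing the increment of the functional by \<open>\<epsilon>\<close> and letting
  \<open>\<epsilon>\<close> tend to 0 gives \<open>3 L(v) \<le> L(v + w) + 2 L(v - w/2)\<close> for all small
  \<open>w\<close>, where \<open>v\<close> is the velocity; the inequality passes to one-sided limits. For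
  \<open>f(s) = L(v + s \<eta>)\<close> it says that \<open>\<phi>(s) = f(s) + 2 f(-s/2)\<close> has a local minimum
  at 0. Since \<open>\<phi>''(0) = 3/2 f''(0) = 0\<close>, also \<open>\<phi>'''(0) = 3/4 f'''(0)\<close> vanishes.
  The slopes must be unequal in size: equal and opposite ones would cancel the cubic term.\<close>

section \<open>Third-order condition in the velocity variable\<close>

text \<open>If \<open>c > 0\<close>, then \<open>f2\<close> is negative just left of its zero at 0,
  so \<open>f1\<close> decreases there to \<open>f1 0 = 0\<close> and is positive, and
  \<open>f\<close> increases strictly up to 0. That contradicts the minimum. The opposite sign of
  \<open>c\<close> is left to reflection.\<close>

lemma third_derivative_le_zero_at_minimum:
  fixes f f1 f2 :: "real \<Rightarrow> real"
  assumes d1: "\<And>x. (f has_real_derivative f1 x) (at x)"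
    and d2: "\<And>x. (f1 has_real_derivative f2 x) (at x)"
    and d3: "(f2 has_real_derivative c) (at 0)"
    and z: "f2 0 = 0" and r: "r > 0" and min: "\<And>x. \<bar>x\<bar> < r \<Longrightarrow> f 0 \<le> f x"
  shows "c \<le> 0"
proof (rule ccontr)
  assume "\<not> c \<le> 0"
  then obtain d where d: "d > 0" "\<And>h. 0 < h \<Longrightarrow> h < d \<Longrightarrow> f2 (0 - h) < f2 0"
    using DERIV_pos_inc_left[OF d3] by auto
  have f1z: "f1 0 = 0"
    using DERIV_local_min[OF d1[of 0] r] min by simp
  \<comment> \<open>Halving keeps the point \<open>-e\<close>, where \<open>f\<close> is finally
    evaluated, strictly inside both ranges.\<close>
  define e where "e = min d r / 2"
  have e: "e > 0" "e < d" "e < r" using d(1) r by (auto simp: e_def)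
  have neg: "f2 x < 0" if "-e \<le> x" "x < 0" for x
    using d(2)[of "-x"] that e z by auto
  have pos: "f1 x > 0" if "-e \<le> x" "x < 0" for x
    using DERIV_neg_imp_decreasing_open[of x 0 f1] d2 neg that f1z
    by (metis DERIV_continuous_on DERIV_subset order_less_imp_le order_trans subset_UNIV)
  have "f (-e) < f 0"
    using DERIV_pos_imp_increasing_open[of "-e" 0 f] d1 pos e
    by (metis DERIV_continuous_on DERIV_subset less_imp_le neg_less_0_iff_less subset_UNIV)
  with min[of "-e"] e show False by simp
qed

text \<open>Passing to \<open>f (-x)\<close> keeps the minimum and the second derivative at 0 and
  reverses the sign of the third, so the one-sided bound applies to \<open>c\<close> and to
  \<open>- c\<close>.\<close>

lemma third_derivative_zero_at_minimum:
  fixes f f1 f2 :: "real \<Rightarrow> real"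
  assumes d1: "\<And>x. (f has_real_derivative f1 x) (at x)"
    and d2: "\<And>x. (f1 has_real_derivative f2 x) (at x)"
    and d3: "(f2 has_real_derivative c) (at 0)"
    and z: "f2 0 = 0" and r: "r > 0" and min: "\<And>x. \<bar>x\<bar> < r \<Longrightarrow> f 0 \<le> f x"
  shows "c = 0"
proof -
  have "c \<le> 0"
    by (rule third_derivative_le_zero_at_minimum[OF d1 d2 d3 z r min])
  moreover have "- c \<le> 0"
  proof (rule third_derivative_le_zero_at_minimum)
    show "((\<lambda>x. f (-x)) has_real_derivative - f1 (-x)) (at x)" for x
      using d1[of "-x"] unfolding DERIV_mirror .
    show "((\<lambda>x. - f1 (-x)) has_real_derivative f2 (-x)) (at x)" for x
      using DERIV_minus[OF d2[of "-x", unfolded DERIV_mirror]] by simp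
    show "((\<lambda>x. f2 (-x)) has_real_derivative - c) (at 0)"
      using d3 DERIV_mirror[of f2 c 0] by simp
  qed (use z r min in auto)
  ultimately show ?thesis by simp
qed

section \<open>Gradient and Hessian in terms of Frechet derivatives\<close>

lemma sum_linear_Basis_inner:
  fixes f :: "'a::euclidean_space \<Rightarrow> real"
  assumes "linear f"
  shows "(\<Sum>b\<in>Basis. f b *\<^sub>R b) \<bullet> h = f h"
proof -
  have "f h = f (\<Sum>b\<in>Basis. (h \<bullet> b) *\<^sub>R b)" by (simp add: euclidean_representation)
  also have "\<dots> = (\<Sum>b\<in>Basis. (h \<bullet> b) * f b)"
    using assms by (simp add: linear_sum linear_scale)
  finally show ?thesis by (simp add: inner_sum_left inner_commute[of h] mult.commute)
qed

text \<open>Replaces the definite description in \<open>gradient\<close> by a finite sum depending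
  continuously on the derivative; limits of gradients are computed from it.\<close>

lemma gradient_eq_sum_Basis:
  fixes f :: "real^'n \<Rightarrow> real"
  assumes "(f has_derivative f') (at v)"
  shows "gradient f v = (\<Sum>b\<in>Basis. f' b *\<^sub>R b)"
proof (rule gradient_eqI)
  have "linear f'" using assms has_derivative_linear by blast
  then have "f' = (\<lambda>h. h \<bullet> (\<Sum>b\<in>Basis. f' b *\<^sub>R b))"
    using sum_linear_Basis_inner[of f'] by (simp add: fun_eq_iff inner_commute)
  then show "GDERIV f v :> (\<Sum>b\<in>Basis. f' b *\<^sub>R b)"
    using assms by (simp add: gderiv_def)
qed

lemma gradient_inner:
  fixes f :: "real^'n \<Rightarrow> real"
  assumes "(f has_derivative f') (at v)"
  shows "gradient f v \<bullet> h = f' h"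
  using sum_linear_Basis_inner[OF has_derivative_linear[OF assms]]
  by (simp add: gradient_eq_sum_Basis[OF assms])

text \<open>The gradient is a fixed linear function of \<open>D1\<close>, so differentiating it only
  replaces \<open>D1\<close> by \<open>D2\<close>. The first formula serves to take limits of
  Hessians, the second to evaluate the quadratic form.\<close>

lemma hessian_eq_matrix:
  fixes f :: "real^'n \<Rightarrow> real"
  assumes d1: "\<And>w. (f has_derivative blinfun_apply (D1 w)) (at w)"
    and d2: "(D1 has_derivative blinfun_apply D2) (at v)"
  shows "hessian f v = matrix (\<lambda>h. \<Sum>b\<in>Basis. blinfun_apply (blinfun_apply D2 h) b *\<^sub>R b)"
    and "\<eta> \<bullet> (hessian f v *v h) = blinfun_apply (blinfun_apply D2 h) \<eta>"
proof -
  let ?H = "\<lambda>h. \<Sum>b\<in>Basis. blinfun_apply (blinfun_apply D2 h) b *\<^sub>R b"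
  have g: "gradient f = (\<lambda>w. \<Sum>b\<in>Basis. blinfun_apply (D1 w) b *\<^sub>R b)"
    using gradient_eq_sum_Basis[OF d1] by auto
  have hd: "(gradient f has_derivative ?H) (at v)"
    unfolding g by (auto intro!: derivative_eq_intros d2)
  show "hessian f v = matrix ?H"
    unfolding hessian_def jacobian_def frechet_derivative_at[OF hd, symmetric] ..
  have "hessian f v *v h = ?H h"
    using fun_cong[OF has_derivative_unique[OF hd jacobian_works[THEN iffD1, OF differentiableI[OF hd]]]]
    unfolding hessian_def by simp
  then show "\<eta> \<bullet> (hessian f v *v h) = blinfun_apply (blinfun_apply D2 h) \<eta>"
    using sum_linear_Basis_inner[OF bounded_linear.linear[OF blinfun.bounded_linear_right],
        of "blinfun_apply D2 h" \<eta>] by (simp add: inner_commute)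
qed

lemma cubic_term_zero:
  fixes g :: "real^'n \<Rightarrow> real"
  assumes d1: "\<And>w. (g has_derivative blinfun_apply (D1 w)) (at w)"
    and d2: "\<And>w. (D1 has_derivative blinfun_apply (D2 w)) (at w)"
    and d3: "\<And>w. (D2 has_derivative blinfun_apply (D3 w)) (at w)"
    and \<rho>: "\<rho> > 0"
    and ineq: "\<And>s. \<bar>s\<bar> < \<rho> \<Longrightarrow> 3 * g v \<le> g (v + s *\<^sub>R \<eta>) + 2 * g (v - (s / 2) *\<^sub>R \<eta>)"
    and zero: "\<eta> \<bullet> (hessian g v *v \<eta>) = 0"
  shows "gradient (\<lambda>u. \<eta> \<bullet> (hessian g u *v \<eta>)) v \<bullet> \<eta> = 0"
proof -
  define \<phi> where "\<phi> s = g (v + s *\<^sub>R \<eta>) + 2 * g (v + (- s / 2) *\<^sub>R \<eta>)" for s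
  \<comment> \<open>The second terms carry the factors 2 * (-1/2) = -1 here and 2 * (1/4) = 1/2 in
    \<open>\<phi>2\<close>; the next one is 2 * (-1/8) = -1/4, which leaves 1 - 1/4 = 3/4 for the
    third derivative at 0.\<close>
  define \<phi>1 where "\<phi>1 s = D1 (v + s *\<^sub>R \<eta>) \<eta> - D1 (v + (- s / 2) *\<^sub>R \<eta>) \<eta>" for s
  define \<phi>2 where "\<phi>2 s = D2 (v + s *\<^sub>R \<eta>) \<eta> \<eta> + D2 (v + (- s / 2) *\<^sub>R \<eta>) \<eta> \<eta> / 2" for s
  \<comment> \<open>The target space is arbitrary because the chain rule is needed for
    \<open>g\<close>, \<open>D1\<close> and \<open>D2\<close>; \<open>c\<close> will be 1 or
    -1/2.\<close>
  have line: "((\<lambda>s. f (v + (c * s) *\<^sub>R \<eta>)) has_vector_derivative c *\<^sub>R f' (v + (c * s) *\<^sub>R \<eta>) \<eta>) (at s)"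
    if "\<And>w. (f has_derivative f' w) (at w)" for f :: "real^'n \<Rightarrow> 'z::real_normed_vector" and f' c s
  proof -
    have "((\<lambda>s. v + (c * s) *\<^sub>R \<eta>) has_vector_derivative c *\<^sub>R \<eta>) (at s)"
      by (auto intro!: derivative_eq_intros)
    from vector_derivative_diff_chain_within[OF this has_derivative_at_withinI[OF that]]
    show ?thesis
      using linear_scale[OF has_derivative_linear[OF that]] by (simp add: o_def)
  qed
  \<comment> \<open>Evaluation at \<eta> is a bounded linear operation, hence commutes with
    differentiation in \<open>s\<close>.\<close>
  have app: "((\<lambda>s. blinfun_apply (F s) \<eta>) has_vector_derivative blinfun_apply F' \<eta>) (at s)"
    if "(F has_vector_derivative F') (at s)"
    for F :: "real \<Rightarrow> (real^'n) \<Rightarrow>\<^sub>L ('z::real_normed_vector)" and F' s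
    using bounded_linear.has_vector_derivative[OF blinfun.bounded_linear_left that] .
  have l1: "((\<lambda>s. g (v + (c * s) *\<^sub>R \<eta>)) has_real_derivative c * D1 (v + (c * s) *\<^sub>R \<eta>) \<eta>) (at s)" for c s
    using line[OF d1, of c s] by (simp add: has_real_derivative_iff_has_vector_derivative)
  have l2: "((\<lambda>s. D1 (v + (c * s) *\<^sub>R \<eta>) \<eta>) has_real_derivative c * D2 (v + (c * s) *\<^sub>R \<eta>) \<eta> \<eta>) (at s)" for c s
    using app[OF line[OF d2, of c s]]
    by (simp add: has_real_derivative_iff_has_vector_derivative blinfun.scaleR_left)
  have l3: "((\<lambda>s. D2 (v + (c * s) *\<^sub>R \<eta>) \<eta> \<eta>) has_real_derivative c * D3 (v + (c * s) *\<^sub>R \<eta>) \<eta> \<eta> \<eta>) (at s)" for c s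
    using app[OF app[OF line[OF d3, of c s]]]
    by (simp add: has_real_derivative_iff_has_vector_derivative blinfun.scaleR_left)
  have quad: "\<eta> \<bullet> (hessian g u *v \<eta>) = D2 u \<eta> \<eta>" for u
    using hessian_eq_matrix(2)[OF d1 d2] .
  have "(3 / 4) * D3 v \<eta> \<eta> \<eta> = 0"
  proof (rule third_derivative_zero_at_minimum[of \<phi> \<phi>1 \<phi>2 _ \<rho>])
    show "(\<phi> has_real_derivative \<phi>1 s) (at s)" for s
      unfolding \<phi>_def \<phi>1_def
      using DERIV_add[OF l1[of 1 s] DERIV_cmult[OF l1[of "-1/2" s], of 2]] by simp
    show "(\<phi>1 has_real_derivative \<phi>2 s) (at s)" for s
      unfolding \<phi>1_def \<phi>2_def
      using DERIV_diff[OF l2[of 1 s] l2[of "-1/2" s]] by simp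
    show "(\<phi>2 has_real_derivative (3 / 4) * D3 v \<eta> \<eta> \<eta>) (at 0)"
      unfolding \<phi>2_def
      using DERIV_add[OF l3[of 1 0] DERIV_cdivide[OF l3[of "-1/2" 0], of 2]] by simp
    show "\<phi>2 0 = 0" using zero by (simp add: \<phi>2_def quad)
    show "\<phi> 0 \<le> \<phi> s" if "\<bar>s\<bar> < \<rho>" for s
      using ineq[OF that] by (simp add: \<phi>_def)
  qed (rule \<rho>)
  \<comment> \<open>In direction \<eta> this derivative is \<open>D3 v \<eta> \<eta> \<eta>\<close>,
    the number just shown to vanish.\<close>
  moreover have "((\<lambda>u. D2 u \<eta> \<eta>) has_derivative (\<lambda>h. D3 v h \<eta> \<eta>)) (at v)"
    using bounded_linear.has_derivative[OF blinfun.bounded_linear_left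
        bounded_linear.has_derivative[OF blinfun.bounded_linear_left d3]] .
  ultimately show ?thesis
    unfolding quad by (simp add: gradient_inner)
qed

section \<open>Piecewise smooth curves\<close>

text \<open>The point \<open>t\<close> may lie in \<open>S\<close>: the filter ignores it, and the
  rest of \<open>S\<close> is closed and misses \<open>t\<close>.\<close>

lemma eventually_at_within_notin_finite:
  fixes t :: "'a::t1_space"
  assumes "finite S"
  shows "eventually (\<lambda>u. u \<notin> S) (at t within T)"
proof -
  have "eventually (\<lambda>u. u \<in> - (S - {t})) (nhds t)"
    using open_Compl[OF finite_imp_closed[OF finite_Diff[OF assms, of "{t}"]]]
    by (rule eventually_nhds_in_open) simp
  then show ?thesis
    unfolding eventually_at_filter by eventually_elim auto
qed

lemma has_vector_derivative_velocity:
  assumes "x differentiable (at t within {t0..t1})"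
  shows "(x has_vector_derivative velocity t0 t1 x t) (at t within {t0..t1})"
  using assms vector_derivative_works velocity_def by metis

lemma velocity_eqI:
  fixes x :: "real \<Rightarrow> real^'n"
  assumes "t0 < t1" "t \<in> {t0..t1}" "(x has_vector_derivative v) (at t within {t0..t1})"
  shows "velocity t0 t1 x t = v"
  unfolding velocity_def using vector_derivative_within_closed_interval[OF assms] .

lemma velocity_add:
  fixes x y :: "real \<Rightarrow> real^'n"
  assumes "t0 < t1" "t \<in> {t0..t1}" "x differentiable (at t within {t0..t1})"
    "y differentiable (at t within {t0..t1})"
  shows "velocity t0 t1 (\<lambda>u. x u + y u) t = velocity t0 t1 x t + velocity t0 t1 y t"
  using assms has_vector_derivative_velocity
  by (intro velocity_eqI has_vector_derivative_add) auto

text \<open>End points are never angular; there the claim is a separate clause of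
  \<open>KC1\<close>. At interior points the two-sided properties restrict to the interval.\<close>

lemma KC1_regular:
  assumes "x \<in> KC1 t0 t1" "t \<in> {t0..t1} - angular_points t0 t1 x"
  shows "x differentiable (at t within {t0..t1})"
    and "continuous (at t within {t0..t1}) (velocity t0 t1 x)"
proof -
  have "x differentiable (at t within {t0..t1}) \<and>
      continuous (at t within {t0..t1}) (velocity t0 t1 x)"
  proof (cases "t \<in> {t0, t1}")
    case True
    then show ?thesis using assms(1) by (auto simp: KC1_def)
  next
    case False
    then have "x differentiable (at t)" "isCont (velocity t0 t1 x) t"
      using assms(2) by (simp_all add: angular_points_def)
    then show ?thesis
      using differentiable_at_withinI continuous_at_imp_continuous_at_within by blast
  qed
  then show "x differentiable (at t within {t0..t1})"
    "continuous (at t within {t0..t1}) (velocity t0 t1 x)" by auto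
qed

lemma KC1_finite_angular: "x \<in> KC1 t0 t1 \<Longrightarrow> finite (angular_points t0 t1 x)"
  by (simp add: KC1_def)

lemma KC1_continuous_on: "x \<in> KC1 t0 t1 \<Longrightarrow> continuous_on {t0..t1} x"
  by (simp add: KC1_def)

lemma angular_points_subset: "angular_points t0 t1 x \<subseteq> {t0<..<t1}"
  by (auto simp: angular_points_def)

text \<open>At an angular point the limit is part of \<open>KC1\<close>; elsewhere continuity of the
  velocity within the interval provides it.\<close>

lemma KC1_right_limit:
  assumes "x \<in> KC1 t0 t1" "t0 \<le> t" "t < t1"
  shows "\<exists>l. (velocity t0 t1 x \<longlongrightarrow> l) (at_right t)"
proof (cases "t \<in> angular_points t0 t1 x")
  case True
  then show ?thesis using assms(1) by (auto simp: KC1_def)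
next
  case False
  with assms have "(velocity t0 t1 x \<longlongrightarrow> velocity t0 t1 x t) (at t within {t0..t1})"
    using KC1_regular(2)[OF assms(1), of t] by (simp add: continuous_within)
  moreover have "at_right t \<le> at t within {t0..t1}"
    unfolding at_within_Icc_at_right[OF assms(3), symmetric] using assms(2) by (intro at_le) auto
  ultimately show ?thesis using tendsto_mono by blast
qed

lemma KC1_left_limit:
  assumes "x \<in> KC1 t0 t1" "t0 < t" "t \<le> t1"
  shows "\<exists>l. (velocity t0 t1 x \<longlongrightarrow> l) (at_left t)"
proof (cases "t \<in> angular_points t0 t1 x")
  case True
  then show ?thesis using assms(1) by (auto simp: KC1_def)
next
  case False
  with assms have "(velocity t0 t1 x \<longlongrightarrow> velocity t0 t1 x t) (at t within {t0..t1})"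
    using KC1_regular(2)[OF assms(1), of t] by (simp add: continuous_within)
  moreover have "at_left t \<le> at t within {t0..t1}"
    unfolding at_within_Icc_at_left[OF assms(2), symmetric] using assms(3) by (intro at_le) auto
  ultimately show ?thesis using tendsto_mono by blast
qed

text \<open>\<open>S\<close> may contain regular points, so a set of suspected corners can be given
  without deciding which of them are real. As \<open>S\<close> avoids the end points, the conditions
  there are among those off \<open>S\<close>.\<close>

lemma KC1_I:
  assumes "t0 < t1" "continuous_on {t0..t1} x" "finite S" "S \<subseteq> {t0<..<t1}"
    and diff: "\<And>t. t \<in> {t0..t1} - S \<Longrightarrow> x differentiable (at t within {t0..t1})"
    and cont: "\<And>t. t \<in> {t0..t1} - S \<Longrightarrow> continuous (at t within {t0..t1}) (velocity t0 t1 x)"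
    and left: "\<And>t. t \<in> S \<Longrightarrow> \<exists>l. (velocity t0 t1 x \<longlongrightarrow> l) (at_left t)"
    and right: "\<And>t. t \<in> S \<Longrightarrow> \<exists>l. (velocity t0 t1 x \<longlongrightarrow> l) (at_right t)"
  shows "x \<in> KC1 t0 t1" "angular_points t0 t1 x \<subseteq> S"
proof -
  show sub: "angular_points t0 t1 x \<subseteq> S"
  proof
    fix t assume t: "t \<in> angular_points t0 t1 x"
    show "t \<in> S"
    proof (rule ccontr)
      assume "t \<notin> S"
      with t diff[of t] cont[of t] show False
        by (simp add: angular_points_def at_within_Icc_at)
    qed
  qed
  have "finite (angular_points t0 t1 x)" using sub assms(3) finite_subset by blast
  moreover have "t0 \<in> {t0..t1} - S" "t1 \<in> {t0..t1} - S" using assms(1,4) by auto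
  ultimately show "x \<in> KC1 t0 t1"
    unfolding KC1_def using assms(2) sub diff cont left right by blast
qed

text \<open>Corners may cancel, hence only an inclusion. Velocities are added off \<open>?S\<close>
  only, since on \<open>?S\<close> they may be unspecified; as \<open>?S\<close> is finite, this
  holds eventually in every punctured neighbourhood, which is enough for limits.\<close>

lemma KC1_add:
  assumes t: "t0 < t1" and x: "x \<in> KC1 t0 t1" and y: "y \<in> KC1 t0 t1"
  shows "(\<lambda>t. x t + y t) \<in> KC1 t0 t1"
    and "angular_points t0 t1 (\<lambda>t. x t + y t) \<subseteq> angular_points t0 t1 x \<union> angular_points t0 t1 y"
proof -
  let ?S = "angular_points t0 t1 x \<union> angular_points t0 t1 y"
  let ?V = "velocity t0 t1"
  have fin: "finite ?S" using x y KC1_finite_angular by blast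
  have sub: "?S \<subseteq> {t0<..<t1}" using angular_points_subset by blast
  have vel: "?V (\<lambda>t. x t + y t) u = ?V x u + ?V y u" if "u \<in> {t0..t1} - ?S" for u
    using that t KC1_regular[OF x] KC1_regular[OF y] by (intro velocity_add) auto
  have ev: "eventually (\<lambda>u. ?V x u + ?V y u = ?V (\<lambda>t. x t + y t) u) (at s within {t0..t1})" for s
    using eventually_at_within_notin_finite[OF fin, of s "{t0..t1}"]
  proof (rule eventually_rev_mp)
    show "eventually (\<lambda>u. u \<notin> ?S \<longrightarrow> ?V x u + ?V y u = ?V (\<lambda>t. x t + y t) u) (at s within {t0..t1})"
      using vel by (auto simp: eventually_at_filter)
  qed
  \<comment> \<open>Covers continuity at regular points and both one-sided limits; only
    \<open>F\<close> changes.\<close>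
  have lim: "(?V (\<lambda>t. x t + y t) \<longlongrightarrow> l + m) F"
    if "(?V x \<longlongrightarrow> l) F" "(?V y \<longlongrightarrow> m) F" "F \<le> at s within {t0..t1}" for l m F and s :: real
    by (rule Lim_transform_eventually[OF tendsto_add[OF that(1,2)] filter_leD[OF that(3) ev]])
  have 1: "(\<lambda>u. x u + y u) differentiable (at s within {t0..t1})" if "s \<in> {t0..t1} - ?S" for s
    using KC1_regular(1)[OF x] KC1_regular(1)[OF y] that by (intro differentiable_add) auto
  have 2: "continuous (at s within {t0..t1}) (?V (\<lambda>t. x t + y t))" if s: "s \<in> {t0..t1} - ?S" for s
    unfolding continuous_within vel[OF s]
    using KC1_regular(2)[OF x] KC1_regular(2)[OF y] s
    by (intro lim[of _ _ _ s]) (auto simp: continuous_within)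
  have 3: "\<exists>l. (?V (\<lambda>t. x t + y t) \<longlongrightarrow> l) (at_left s)" if s: "s \<in> ?S" for s
  proof -
    have s': "t0 < s" "s \<le> t1" using s sub by auto
    have "at_left s \<le> at s within {t0..t1}"
      using s' unfolding at_within_Icc_at_left[OF s'(1), symmetric] by (intro at_le) auto
    then show ?thesis
      using lim KC1_left_limit[OF x s'] KC1_left_limit[OF y s'] by meson
  qed
  have 4: "\<exists>l. (?V (\<lambda>t. x t + y t) \<longlongrightarrow> l) (at_right s)" if s: "s \<in> ?S" for s
  proof -
    have s': "t0 \<le> s" "s < t1" using s sub by auto
    have "at_right s \<le> at s within {t0..t1}"
      using s' unfolding at_within_Icc_at_right[OF s'(2), symmetric] by (intro at_le) auto
    then show ?thesis
      using lim KC1_right_limit[OF x s'] KC1_right_limit[OF y s'] by meson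
  qed
  have c: "continuous_on {t0..t1} (\<lambda>t. x t + y t)"
    using x y by (intro continuous_intros KC1_continuous_on)
  show "(\<lambda>t. x t + y t) \<in> KC1 t0 t1" "angular_points t0 t1 (\<lambda>t. x t + y t) \<subseteq> ?S"
    using KC1_I[OF t c fin sub 1 2 3 4] by auto
qed

section \<open>Ramps, the pieces of the saw-tooth\<close>

lemma has_vector_derivative_ramp:
  fixes w :: "real^'n"
  assumes "t \<noteq> c"
  shows "((\<lambda>t. max 0 (t - c) *\<^sub>R w) has_vector_derivative (if t < c then 0 else w)) (at t)"
proof (cases "t < c")
  case True
  have "((\<lambda>t. 0 :: real^'n) has_vector_derivative 0) (at t)" by simp
  then have "((\<lambda>t. max 0 (t - c) *\<^sub>R w) has_vector_derivative 0) (at t)"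
    by (rule has_vector_derivative_transform_within_open[where S = "{..<c}"]) (use True in auto)
  then show ?thesis using True by simp
next
  case False
  have "((\<lambda>t. (t - c) *\<^sub>R w) has_vector_derivative w) (at t)"
    by (auto intro!: derivative_eq_intros)
  then have "((\<lambda>t. max 0 (t - c) *\<^sub>R w) has_vector_derivative w) (at t)"
    by (rule has_vector_derivative_transform_within_open[where S = "{c<..}"])
      (use False assms in auto)
  then show ?thesis using False by simp
qed

text \<open>Off \<open>c\<close> the velocity is locally constant. For \<open>w = 0\<close> there is
  no corner at all, hence only an inclusion.\<close>

lemma ramp_KC1:
  fixes w :: "real^'n"
  assumes c: "t0 < c" "c < t1"
  defines "y \<equiv> \<lambda>t. max 0 (t - c) *\<^sub>R w"
  shows "y \<in> KC1 t0 t1" "angular_points t0 t1 y \<subseteq> {c}"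
    and "\<And>t. t \<in> {t0..t1} - {c} \<Longrightarrow> velocity t0 t1 y t = (if t < c then 0 else w)"
proof -
  show vel: "velocity t0 t1 y t = (if t < c then 0 else w)" if "t \<in> {t0..t1} - {c}" for t
    unfolding y_def
    by (rule velocity_eqI[OF _ _ has_vector_derivative_at_within[OF has_vector_derivative_ramp]])
      (use that c in auto)
  have cl: "eventually (\<lambda>t. 0 = velocity t0 t1 y t) (at s within {t0..t1})" if "s < c" for s
  proof -
    have "eventually (\<lambda>t. t < c) (at s within {t0..t1})"
      using order_tendstoD(2)[OF tendsto_ident_at that] .
    moreover have "eventually (\<lambda>t. t \<in> {t0..t1}) (at s within {t0..t1})"
      by (simp add: eventually_at_filter)
    ultimately show ?thesis by eventually_elim (simp add: vel)
  qed
  have cr: "eventually (\<lambda>t. w = velocity t0 t1 y t) (at s within {t0..t1})" if "c < s" for s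
  proof -
    have "eventually (\<lambda>t. t > c) (at s within {t0..t1})"
      using order_tendstoD(1)[OF tendsto_ident_at that] .
    moreover have "eventually (\<lambda>t. t \<in> {t0..t1}) (at s within {t0..t1})"
      by (simp add: eventually_at_filter)
    ultimately show ?thesis by eventually_elim (simp add: vel)
  qed
  have 1: "y differentiable (at t within {t0..t1})" if "t \<in> {t0..t1} - {c}" for t
    using has_vector_derivative_ramp[of t c w] that
    unfolding y_def by (auto intro: differentiableI_vector differentiable_at_withinI)
  have 2: "continuous (at s within {t0..t1}) (velocity t0 t1 y)" if s: "s \<in> {t0..t1} - {c}" for s
    unfolding continuous_within vel[OF s]
    using s Lim_transform_eventually[OF tendsto_const cl, of s]
      Lim_transform_eventually[OF tendsto_const cr, of s] by auto
  have 3: "(velocity t0 t1 y \<longlongrightarrow> 0) (at_left c)"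
  proof (rule Lim_transform_eventually[OF tendsto_const])
    show "eventually (\<lambda>t. 0 = velocity t0 t1 y t) (at_left c)"
      using eventually_at_left_real[OF c(1)] by eventually_elim (use c vel in auto)
  qed
  have 4: "(velocity t0 t1 y \<longlongrightarrow> w) (at_right c)"
  proof (rule Lim_transform_eventually[OF tendsto_const])
    show "eventually (\<lambda>t. w = velocity t0 t1 y t) (at_right c)"
      using eventually_at_right_real[OF c(2)] by eventually_elim (use c vel in auto)
  qed
  have 5: "continuous_on {t0..t1} y" unfolding y_def by (intro continuous_intros)
  show "y \<in> KC1 t0 t1" "angular_points t0 t1 y \<subseteq> {c}"
    using KC1_I[of t0 t1 y "{c}"] 1 2 3 4 5 c by auto
qed

section \<open>Integrability of the Lagrangian along a curve\<close>

lemma continuous_on_fun_upd_limit: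
  fixes f :: "'a::t1_space \<Rightarrow> 'b::topological_space"
  assumes "continuous_on (S - {t}) f" "(f \<longlongrightarrow> l) (at t within S)"
  shows "continuous_on S (f(t := l))"
  unfolding continuous_on_def
proof
  fix u assume u: "u \<in> S"
  show "(f(t := l) \<longlongrightarrow> (f(t := l)) u) (at u within S)"
  proof (cases "u = t")
    case True
    have "(f(t := l) \<longlongrightarrow> l) (at t within S)"
      using assms(2) by (rule Lim_transform_eventually) (auto simp: eventually_at_filter)
    then show ?thesis using True by simp
  next
    case False
    have "(f \<longlongrightarrow> f u) (at u within (S - {t}))"
      using assms(1) u False by (auto simp: continuous_on_def)
    then have "(f(t := l) \<longlongrightarrow> f u) (at u within (S - {t}))"
      by (rule Lim_transform_eventually) (auto simp: eventually_at_filter)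
    moreover have "at u within (S - {t}) = at u within S"
      by (rule at_within_nhd[of u "- {t}"]) (use False in auto)
    ultimately show ?thesis using False by simp
  qed
qed

text \<open>Integrability is additive over adjacent intervals, so by bisection it suffices locally.
  A short interval around \<open>s\<close> has no angular point other than possibly
  \<open>s\<close>, and on each side the integrand extends continuously up to
  \<open>s\<close>.\<close>

lemma KC1_Lagrangian_integrable:
  fixes L :: "real \<Rightarrow> real^'n \<Rightarrow> real^'n \<Rightarrow> real"
  assumes t: "t0 < t1" and x: "x \<in> KC1 t0 t1"
    and L: "continuous_on (T \<times> UNIV \<times> UNIV) (\<lambda>(t, x, v). L t x v)" and T: "{t0..t1} \<subseteq> T"
  shows "(\<lambda>t. L t (x t) (velocity t0 t1 x t)) integrable_on {t0..t1}"
proof -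
  let ?G = "\<lambda>t. L t (x t) (velocity t0 t1 x t)"
  have piece: "?G integrable_on {c..d}"
    if sub: "{c..d} \<subseteq> {t0..t1}" and co: "continuous_on ({c..d} - {s}) (velocity t0 t1 x)"
      and l: "(velocity t0 t1 x \<longlongrightarrow> l) (at s within {c..d})" for c d s l
  proof -
    \<comment> \<open>The possibly unspecified velocity at \<open>s\<close> is replaced by its limit
      from within the piece; changing a single value does not affect integrability.\<close>
    let ?v = "(velocity t0 t1 x)(s := l)"
    have "continuous_on {c..d} (\<lambda>t. (t, x t, ?v t))"
      using continuous_on_fun_upd_limit[OF co l] continuous_on_subset[OF KC1_continuous_on[OF x] sub]
      by (intro continuous_on_Pair continuous_on_id)
    moreover have "(\<lambda>t. (t, x t, ?v t)) ` {c..d} \<subseteq> T \<times> UNIV \<times> UNIV"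
      using sub T by auto
    ultimately have "continuous_on {c..d} (\<lambda>t. L t (x t) (?v t))"
      using continuous_on_compose2[OF L] by fastforce
    then have "(\<lambda>t. L t (x t) (?v t)) integrable_on {c..d}"
      by (rule integrable_continuous_real)
    then show ?thesis
      by (rule integrable_spike_finite[of "{s}", rotated 2]) auto
  qed
  have reg: "continuous_on S (velocity t0 t1 x)" if "S \<subseteq> {t0..t1} - angular_points t0 t1 x" for S
    unfolding continuous_on_eq_continuous_within
    using that KC1_regular(2)[OF x] continuous_within_subset by blast
  \<comment> \<open>The bounds on \<open>a\<close> and \<open>b\<close> belong to the induction
    predicate because small intervals around a point may stick out of
    \<open>{t0..t1}\<close>.\<close>
  have "t0 \<le> t0 \<longrightarrow> t1 \<le> t1 \<longrightarrow> ?G integrable_on {t0..t1}"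
  proof (induction rule: Bolzano[OF less_imp_le[OF t], where P = "\<lambda>a b. t0 \<le> a \<longrightarrow> b \<le> t1 \<longrightarrow> ?G integrable_on {a..b}"])
    case (1 a b c)
    then show ?case
      by (intro impI Henstock_Kurzweil_Integration.integrable_combine[of a b c ?G]) auto
  next
    case (2 s)
    have "eventually (\<lambda>u. u \<notin> angular_points t0 t1 x) (at s)"
      using eventually_at_within_notin_finite[OF KC1_finite_angular[OF x]] .
    then obtain d where d: "d > 0" "\<And>u. u \<noteq> s \<Longrightarrow> \<bar>u - s\<bar> < d \<Longrightarrow> u \<notin> angular_points t0 t1 x"
      unfolding eventually_at by (auto simp: dist_real_def)
    have "?G integrable_on {a..b}" if ab: "a \<le> s" "s \<le> b" "b - a < d" "t0 \<le> a" "b \<le> t1" for a b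
    proof -
      \<comment> \<open>If \<open>s\<close> is an end point of \<open>{a..b}\<close>, one half
        degenerates; this includes \<open>t0\<close> and \<open>t1\<close>, where only one of the
        two limits is available.\<close>
      have R: "?G integrable_on {s..b}"
      proof (cases "s < b")
        case True
        obtain l where "(velocity t0 t1 x \<longlongrightarrow> l) (at_right s)"
          using KC1_right_limit[OF x, of s] True ab by auto
        then show ?thesis
          using True ab d(2) by (intro piece[of s b s l] reg) (auto simp: at_within_Icc_at_right)
      next
        case False
        then have "s = b" using ab by simp
        then show ?thesis using integrable_on_refl[of ?G b] by simp
      qed
      have "?G integrable_on {a..s}"
      proof (cases "a < s")
        case True
        obtain l where "(velocity t0 t1 x \<longlongrightarrow> l) (at_left s)"
          using KC1_left_limit[OF x, of s] True ab by auto
        then show ?thesis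
          using True ab d(2) by (intro piece[of a s s l] reg) (auto simp: at_within_Icc_at_left)
      next
        case False
        then have "a = s" using ab by simp
        then show ?thesis using integrable_on_refl[of ?G a] by simp
      qed
      with R ab show ?thesis using Henstock_Kurzweil_Integration.integrable_combine by blast
    qed
    with d(1) show ?case by blast
  qed
  then show ?thesis by simp
qed

section \<open>Needle variations\<close>

text \<open>Velocities are controlled only off finitely many points; there \<open>f\<close> is
  redefined as \<open>g\<close>, which leaves its integral unchanged.\<close>

lemma integral_le_finite_exceptions:
  fixes f g :: "real \<Rightarrow> real"
  assumes "f integrable_on I" "g integrable_on I" "finite S" "\<And>x. x \<in> I - S \<Longrightarrow> f x \<le> g x"
  shows "integral I f \<le> integral I g"
proof -
  let ?f = "\<lambda>x. if x \<in> S then g x else f x"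
  have "integral I f = integral I ?f"
    using assms(3) by (intro integral_spike[of S]) (auto simp: negligible_finite)
  moreover have "?f integrable_on I"
    by (rule integrable_spike_finite[OF assms(3) _ assms(1)]) auto
  ultimately show ?thesis
    using assms(2,4) by (auto intro!: integral_le)
qed

text \<open>Bounding the essential supremum needs measurability. Since \<open>v\<close> may be
  unspecified on \<open>S\<close>, measurability is inherited from the Borel function
  \<open>u\<close>, and \<open>S\<close> is null.\<close>

lemma Linf_norm_le:
  fixes v u :: "real \<Rightarrow> real^'n"
  assumes "finite S" and u: "u \<in> borel_measurable borel"
    and eq: "\<And>t. t \<in> {t0..t1} - S \<Longrightarrow> v t = u t"
    and le: "\<And>t. t \<in> {t0..t1} - S \<Longrightarrow> norm (u t) \<le> c"
  shows "Linf_norm t0 t1 v \<le> ereal c"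
  unfolding Linf_norm_def
proof (rule esssup_I)
  let ?S = "S \<inter> {t0..t1}"
  have null: "?S \<in> null_sets (lebesgue_on {t0..t1})"
    using assms(1) by (subst null_sets_restrict_space)
      (auto simp flip: negligible_iff_null_sets)
  have "(\<lambda>t. ereal (norm (u t))) \<in> borel_measurable (lebesgue_on {t0..t1})"
    using u by (intro measurable_restrict_space1 measurable_completion) simp
  then show "(\<lambda>t. ereal (norm (v t))) \<in> borel_measurable (lebesgue_on {t0..t1})"
  proof (rule measurable_discrete_difference[where X = ?S])
    show "countable ?S" using assms(1) by (simp add: countable_finite)
    show "{t} \<in> sets (lebesgue_on {t0..t1})" if "t \<in> ?S" for t
      using that by (auto simp: sets_restrict_space_iff)
  qed (use eq in auto)
  show "AE t in lebesgue_on {t0..t1}. ereal (norm (v t)) \<le> ereal c"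
    by (rule AE_I'[OF null]) (use eq le in force)
qed

text \<open>If the inequality failed, a short saw-tooth starting at \<open>p\<close> would lower the
  functional. The bound on \<open>w\<close> does not depend on \<open>p\<close>; this uniformity
  later lets the inequality pass to limits of the velocity.\<close>

lemma needle_inequality:
  fixes L :: "real \<Rightarrow> real^'n \<Rightarrow> real^'n \<Rightarrow> real"
  assumes t: "t0 < t1" and T: "{t0..t1} \<subseteq> T" "open T"
    and L: "continuous_on (T \<times> UNIV \<times> UNIV) (\<lambda>(t, x, v). L t x v)"
    and adm: "admissible t0 t1 x0 x1 xb" and \<delta>: "\<delta> > 0"
    and min: "\<And>x. admissible t0 t1 x0 x1 x \<Longrightarrow>
        C_norm t0 t1 (\<lambda>t. x t - xb t) \<le> \<delta> \<Longrightarrow>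
        Linf_norm t0 t1 (\<lambda>t. velocity t0 t1 x t - velocity t0 t1 xb t) \<le> ereal \<delta> \<Longrightarrow>
        J L t0 t1 xb \<le> J L t0 t1 x"
    and p: "p \<in> {t0<..<t1} - angular_points t0 t1 xb"
    and w: "norm w \<le> \<delta>"
  defines "v \<equiv> velocity t0 t1 xb"
  shows "3 * L p (xb p) (v p) \<le> L p (xb p) (v p + w) + 2 * L p (xb p) (v p - (1 / 2) *\<^sub>R w)"
proof (rule ccontr)
  define A where "A = L p (xb p) (v p + w)"
  define B where "B = L p (xb p) (v p - (1 / 2) *\<^sub>R w)"
  define C where "C = L p (xb p) (v p)"
  \<comment> \<open>The gap \<open>3 * C - A - 2 * B\<close> equals \<open>12 * e\<close>. The
    estimates below lose \<open>2 * e\<close> over a total length \<open>3 * \<epsilon>\<close>, so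
    half of the gap survives.\<close>
  define e where "e = (3 * C - A - 2 * B) / 12"
  assume "\<not> ?thesis"
  then have e: "e > 0" by (simp add: e_def A_def B_def C_def)
  have xb: "xb \<in> KC1 t0 t1" using adm by (simp add: admissible_def)
  have vp: "isCont v p" and xp: "isCont xb p"
    using p differentiable_imp_continuous_within[of xb p UNIV]
    by (auto simp: angular_points_def v_def)
  have openU: "open (T \<times> (UNIV :: (real^'n) set) \<times> (UNIV :: (real^'n) set))"
    by (intro open_Times T(2) open_UNIV)
  \<comment> \<open>Treating the shift \<open>y\<close> of the position as a variable covers both
    the perturbed curve and, with \<open>y = 0\<close>, the original one. The offset
    \<open>u\<close> will be \<open>w\<close>, \<open>-w/2\<close> and 0.\<close>
  have near: "\<exists>r>0. \<forall>s y. \<bar>s - p\<bar> < r \<longrightarrow> norm y < r \<longrightarrow>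
      \<bar>L s (xb s + y) (v s + u) - L p (xb p) (v p + u)\<bar> < e" for u
  proof -
    let ?F = "\<lambda>z. (fst z, xb (fst z) + snd z, v (fst z) + u)"
    have "?F (p, 0) \<in> T \<times> UNIV \<times> UNIV" using p T(1) by auto
    then have "isCont (\<lambda>(t, x, v). L t x v) (?F (p, 0))"
      using L unfolding continuous_on_eq_continuous_at[OF openU] by (rule bspec[rotated])
    moreover have "isCont (\<lambda>z. xb (fst z)) (p, 0 :: real^'n)" "isCont (\<lambda>z. v (fst z)) (p, 0 :: real^'n)"
      using xp vp by (auto intro!: isCont_o2[where f = fst] continuous_intros)
    then have "isCont ?F (p, 0)"
      by (intro continuous_intros)
    ultimately have "isCont (\<lambda>z. (\<lambda>(t, x, v). L t x v) (?F z)) (p, 0)"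
      by (rule isCont_o2[rotated])
    then obtain d where d: "d > 0" "\<And>z. dist z (p, 0) < d \<Longrightarrow>
        dist (L (fst z) (xb (fst z) + snd z) (v (fst z) + u)) (L p (xb p) (v p + u)) < e"
      using e unfolding continuous_at_eps_delta by (auto simp: split_beta)
    have "\<bar>L s (xb s + y) (v s + u) - L p (xb p) (v p + u)\<bar> < e"
      if "\<bar>s - p\<bar> < d / 2" "norm y < d / 2" for s y
    proof -
      have "dist (s, y) (p, 0) \<le> \<bar>s - p\<bar> + norm y"
        unfolding dist_Pair_Pair by (simp add: dist_real_def sqrt_sum_squares_le_sum_abs[of "s - p" "norm y", simplified])
      then show ?thesis using d(2)[of "(s, y)"] that by (simp add: dist_real_def)
    qed
    then show ?thesis using d(1) by (intro exI[of _ "d / 2"]) auto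
  qed
  obtain r1 where r1: "r1 > 0" "\<And>s y. \<bar>s - p\<bar> < r1 \<Longrightarrow> norm y < r1 \<Longrightarrow>
      \<bar>L s (xb s + y) (v s + w) - A\<bar> < e"
    using near[of w] unfolding A_def by blast
  obtain r2 where r2: "r2 > 0" "\<And>s y. \<bar>s - p\<bar> < r2 \<Longrightarrow> norm y < r2 \<Longrightarrow>
      \<bar>L s (xb s + y) (v s - (1/2) *\<^sub>R w) - B\<bar> < e"
    using near[of "- ((1/2) *\<^sub>R w)"] unfolding B_def by auto
  obtain r3 where r3: "r3 > 0" "\<And>s y. \<bar>s - p\<bar> < r3 \<Longrightarrow> norm y < r3 \<Longrightarrow>
      \<bar>L s (xb s + y) (v s) - C\<bar> < e"
    using near[of 0] unfolding C_def by auto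
  define m where "m = Min {r1, r2, r3, \<delta>, t1 - p}"
  have m: "m > 0" "m \<le> r1" "m \<le> r2" "m \<le> r3" "m \<le> \<delta>" "m \<le> t1 - p"
    using r1(1) r2(1) r3(1) \<delta> p by (auto simp: m_def)
  \<comment> \<open>Both the length \<open>3 * \<epsilon>\<close> of the support and the height
    bound \<open>\<epsilon> * norm w\<close> must be below \<open>m\<close>; adding 1 to
    \<open>norm w\<close> avoids division by zero for \<open>w = 0\<close>.\<close>
  define \<epsilon> where "\<epsilon> = m / (6 * (1 + norm w))"
  have nw: "1 + norm w > 0" using norm_ge_zero[of w] by linarith
  have \<epsilon>0: "\<epsilon> > 0" using m(1) nw by (simp add: \<epsilon>_def)
  have "6 * \<epsilon> + 6 * (\<epsilon> * norm w) = m"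
  proof -
    have "\<epsilon> * (6 * (1 + norm w)) = m"
      using nw by (intro nonzero_eq_divide_eq[THEN iffD1]) (auto simp: \<epsilon>_def)
    then show ?thesis by (simp add: algebra_simps)
  qed
  then have \<epsilon>: "3 * \<epsilon> < m" "\<epsilon> * norm w < m"
    using \<epsilon>0 mult_nonneg_nonneg[OF less_imp_le[OF \<epsilon>0] norm_ge_zero[of w]] by linarith+
  define q where "q = p + \<epsilon>"
  define r where "r = p + 3 * \<epsilon>"
  have ord: "t0 < p" "p < q" "q < r" "r < t1"
    using p \<epsilon>0 \<epsilon> m by (auto simp: q_def r_def)
  then have p01: "t0 < p" "p < t1" and q01: "t0 < q" "q < t1" and r01: "t0 < r" "r < t1"
    by auto
  define R where "R c u = (\<lambda>t. max 0 (t - c) *\<^sub>R u)" for c :: real and u :: "real^'n"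
  \<comment> \<open>The saw-tooth is a sum of ramps so that \<open>KC1_add\<close> applies.\<close>
  define h where "h t = R p w t + (R q (- (3/2) *\<^sub>R w) t + R r ((1/2) *\<^sub>R w) t)" for t
  \<comment> \<open>The coefficients are the slope jumps: 0 to 1 at \<open>p\<close>, 1 to -1/2 at
    \<open>q\<close>, -1/2 to 0 at \<open>r\<close>. The rise over length \<epsilon> is undone over
    length 2 \<epsilon>, so \<open>k\<close> vanishes again from \<open>r\<close> on.\<close>
  define k where "k t = max 0 (t - p) - 3/2 * max 0 (t - q) + 1/2 * max 0 (t - r)" for t
  define \<sigma> :: "real \<Rightarrow> real" where "\<sigma> t = (if t < p then 0 else if t < q then 1 else if t < r then - 1/2 else 0)" for t
  define x where "x t = xb t + h t" for t
  have hk: "h t = k t *\<^sub>R w" for t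
    by (simp add: h_def R_def k_def scaleR_left_diff_distrib scaleR_left_distrib)
  have k: "0 \<le> k t" "k t \<le> \<epsilon>" for t
    using \<epsilon>0 by (auto simp: k_def q_def r_def max_def field_simps)
  have k0: "k t = 0" if "t \<le> p \<or> r \<le> t" for t
    using that \<epsilon>0 by (auto simp: k_def q_def r_def max_def field_simps)
  have Rp: "R p w \<in> KC1 t0 t1" "angular_points t0 t1 (R p w) \<subseteq> {p}"
    "\<And>t. t \<in> {t0..t1} - {p} \<Longrightarrow> velocity t0 t1 (R p w) t = (if t < p then 0 else w)"
    unfolding R_def using ramp_KC1[OF p01, where w = w] by simp_all
  have Rq: "R q u \<in> KC1 t0 t1" "angular_points t0 t1 (R q u) \<subseteq> {q}"
    "\<And>t. t \<in> {t0..t1} - {q} \<Longrightarrow> velocity t0 t1 (R q u) t = (if t < q then 0 else u)" for u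
    unfolding R_def using ramp_KC1[OF q01, where w = u] by simp_all
  have Rr: "R r u \<in> KC1 t0 t1" "angular_points t0 t1 (R r u) \<subseteq> {r}"
    "\<And>t. t \<in> {t0..t1} - {r} \<Longrightarrow> velocity t0 t1 (R r u) t = (if t < r then 0 else u)" for u
    unfolding R_def using ramp_KC1[OF r01, where w = u] by simp_all
  note Rqr = KC1_add[OF t Rq(1) Rr(1)]
  have h: "h \<in> KC1 t0 t1" "angular_points t0 t1 h \<subseteq> {p, q, r}"
    unfolding h_def using KC1_add[OF t Rp(1) Rqr(1)] Rp(2) Rqr(2) Rq(2) Rr(2) by blast+
  have xK: "x \<in> KC1 t0 t1" unfolding x_def using KC1_add(1)[OF t xb h(1)] .
  \<comment> \<open>At these points velocities may be unspecified, so the velocity formulas below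
    are claimed only off \<open>S\<close>.\<close>
  define S where "S = angular_points t0 t1 xb \<union> {p, q, r}"
  have S: "finite S" using KC1_finite_angular[OF xb] by (simp add: S_def)
  have velh: "velocity t0 t1 h s = \<sigma> s *\<^sub>R w" if s: "s \<in> {t0..t1} - S" for s
  proof -
    have reg: "s \<in> {t0..t1} - angular_points t0 t1 (R p w)"
      "s \<in> {t0..t1} - angular_points t0 t1 (R q u)"
      "s \<in> {t0..t1} - angular_points t0 t1 (R r u)"
      "s \<in> {t0..t1} - angular_points t0 t1 (\<lambda>t. R q u t + R r u' t)" for u u'
      using s Rp(2) Rq(2) Rr(2) Rqr(2) unfolding S_def by blast+
    have "velocity t0 t1 h s = velocity t0 t1 (R p w) s + (velocity t0 t1 (R q (- (3/2) *\<^sub>R w)) s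
        + velocity t0 t1 (R r ((1/2) *\<^sub>R w)) s)"
      unfolding h_def using t s
      by (simp add: velocity_add KC1_regular(1)[OF Rp(1) reg(1)] KC1_regular(1)[OF Rq(1) reg(2)]
          KC1_regular(1)[OF Rr(1) reg(3)] KC1_regular(1)[OF Rqr(1) reg(4)])
    also have "\<dots> = \<sigma> s *\<^sub>R w"
      using s ord by (auto simp: Rp(3) Rq(3) Rr(3) S_def \<sigma>_def vec_eq_iff)
    finally show ?thesis .
  qed
  have velx: "velocity t0 t1 x s = v s + \<sigma> s *\<^sub>R w" if s: "s \<in> {t0..t1} - S" for s
  proof -
    have "velocity t0 t1 x s = v s + velocity t0 t1 h s"
      unfolding x_def v_def using s h t
      by (intro velocity_add KC1_regular(1)[OF xb] KC1_regular(1)[OF h(1)]) (auto simp: S_def)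
    then show ?thesis using velh[OF s] by simp
  qed
  have "J L t0 t1 xb \<le> J L t0 t1 x"
  proof (rule min)
    show "admissible t0 t1 x0 x1 x"
      using adm xK ord by (auto simp: admissible_def x_def hk k0)
    have "norm (h s) \<le> \<delta>" for s
    proof -
      have "norm (h s) \<le> \<epsilon> * norm w"
        unfolding hk norm_scaleR using k[of s] by (intro mult_right_mono) auto
      then show ?thesis using \<epsilon> m by linarith
    qed
    then show "C_norm t0 t1 (\<lambda>t. x t - xb t) \<le> \<delta>"
      unfolding C_norm_def using t by (intro cSUP_least) (auto simp: x_def)
    \<comment> \<open>The steepest slope is \<open>w\<close> itself, so
      \<open>norm w \<le> \<delta>\<close> gives the bound on the velocity difference.\<close>
    have "\<bar>\<sigma> s\<bar> * norm w \<le> 1 * norm w" for s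
      by (rule mult_right_mono) (auto simp: \<sigma>_def)
    then have "norm (\<sigma> s *\<^sub>R w) \<le> \<delta>" for s
      using w order_trans by fastforce
    moreover have "(\<lambda>s. \<sigma> s *\<^sub>R w) \<in> borel_measurable borel"
      unfolding \<sigma>_def by measurable
    ultimately show "Linf_norm t0 t1 (\<lambda>t. velocity t0 t1 x t - velocity t0 t1 xb t) \<le> ereal \<delta>"
      using velx by (intro Linf_norm_le[OF S, of "\<lambda>s. \<sigma> s *\<^sub>R w"]) (auto simp: v_def)
  qed
  moreover have "J L t0 t1 x < J L t0 t1 xb"
  proof -
    let ?G = "\<lambda>x s. L s (x s) (velocity t0 t1 x s)"
    \<comment> \<open>Between \<open>p\<close> and \<open>r\<close>, off \<open>S\<close>, each
      Lagrangian value is within \<open>e\<close> of its frozen value, \<open>A\<close> or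
      \<open>B\<close> along \<open>x\<close> and \<open>C\<close> along \<open>xb\<close>; hence
      \<open>2 * e\<close>. Outside, the integrands agree. The double count at \<open>q\<close> is
      harmless since \<open>q\<close> lies in \<open>S\<close>.\<close>
    let ?H = "\<lambda>s. (if s \<in> {p..q} then A - C + 2 * e else 0) + (if s \<in> {q..r} then B - C + 2 * e else 0)"
    have iG: "?G x integrable_on {t0..t1}" "?G xb integrable_on {t0..t1}"
      using KC1_Lagrangian_integrable[OF t _ L T(1)] xK xb by auto
    have "((\<lambda>s. if s \<in> {p..q} then A - C + 2 * e else 0) has_integral (q - p) * (A - C + 2 * e)) {t0..t1}"
      using ord has_integral_const_real[of "A - C + 2 * e" p q]
      by (subst has_integral_restrict) auto
    moreover have "((\<lambda>s. if s \<in> {q..r} then B - C + 2 * e else 0) has_integral (r - q) * (B - C + 2 * e)) {t0..t1}"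
      using ord has_integral_const_real[of "B - C + 2 * e" q r]
      by (subst has_integral_restrict) auto
    ultimately have H: "(?H has_integral (q - p) * (A - C + 2 * e) + (r - q) * (B - C + 2 * e)) {t0..t1}"
      by (rule has_integral_add)
    have le: "?G x s - ?G xb s \<le> ?H s" if s: "s \<in> {t0..t1} - S" for s
    proof -
      have ne: "s \<noteq> p" "s \<noteq> q" "s \<noteq> r" using s by (auto simp: S_def)
      have small: "norm (h s) < m"
      proof -
        have "norm (h s) \<le> \<epsilon> * norm w"
          unfolding hk norm_scaleR using k[of s] by (intro mult_right_mono) auto
        then show ?thesis using \<epsilon> by linarith
      qed
      consider "s < p \<or> r < s" | "p < s" "s < q" | "q < s" "s < r"
        using ne by linarith
      then show ?thesis
      proof cases
        case 1
        then show ?thesis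
          using ord velx[OF s] hk[of s] k0[of s] by (auto simp: x_def v_def \<sigma>_def)
      next
        case 2
        then have "\<bar>s - p\<bar> < m" using \<epsilon> \<epsilon>0 by (auto simp: q_def)
        then show ?thesis
          using 2 ord velx[OF s] small m r1(2)[of s "h s"] r3(2)[of s 0] by (simp add: x_def v_def \<sigma>_def)
      next
        case 3
        then have "\<bar>s - p\<bar> < m" using \<epsilon> \<epsilon>0 by (auto simp: q_def r_def)
        then show ?thesis
          using 3 ord velx[OF s] small m r2(2)[of s "h s"] r3(2)[of s 0] by (simp add: x_def v_def \<sigma>_def)
      qed
    qed
    have "J L t0 t1 x - J L t0 t1 xb = integral {t0..t1} (\<lambda>s. ?G x s - ?G xb s)"
      unfolding J_def using iG by (simp add: integral_diff)
    also have "\<dots> \<le> integral {t0..t1} ?H"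
      using integral_le_finite_exceptions[OF integrable_diff[OF iG] has_integral_integrable[OF H] S le] .
    also have "\<dots> = (q - p) * (A - C + 2 * e) + (r - q) * (B - C + 2 * e)"
      using H by (rule integral_unique)
    \<comment> \<open>Uses \<open>q - p = \<epsilon>\<close>, \<open>r - q = 2 * \<epsilon>\<close>
      and \<open>A + 2 * B - 3 * C = - 12 * e\<close>.\<close>
    also have "\<dots> = - 6 * e * \<epsilon>"
      by (simp add: q_def r_def e_def field_simps)
    also have "\<dots> < 0" using e \<epsilon>0 by simp
    finally show ?thesis by simp
  qed
  ultimately show False by simp
qed

section \<open>Regular points and passage to one-sided limits\<close>

theorem theorem3p6:
  fixes L :: "real \<Rightarrow> real^'n \<Rightarrow> real^'n \<Rightarrow> real"
    and a b :: ereal and t0 t1 :: real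
    and x0 x1 \<eta> :: "real^'n" and xb :: "real \<Rightarrow> real^'n"
  assumes "t0 < t1" and "{t0..t1} \<subseteq> einterval a b"
    and "C1_total (einterval a b \<times> UNIV \<times> UNIV) L"
    and "C3_last (einterval a b \<times> UNIV \<times> UNIV) L"
    and "weak_local_minimum L t0 t1 x0 x1 xb"
    and "\<eta> \<noteq> 0"
  shows "(\<forall>\<theta> \<in> {t0<..<t1} - angular_points t0 t1 xb.
            \<eta> \<bullet> (Lbar_vv L t0 t1 xb \<theta> *v \<eta>) = 0 \<longrightarrow>
            grad_quad_Lbar_vv L t0 t1 xb \<eta> \<theta> \<bullet> \<eta> = 0) \<and>
         (\<forall>\<theta> \<in> {t0} \<union> angular_points t0 t1 xb.
            \<eta> \<bullet> (right_lim (Lbar_vv L t0 t1 xb) \<theta> *v \<eta>) = 0 \<longrightarrow>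
            right_lim (grad_quad_Lbar_vv L t0 t1 xb \<eta>) \<theta> \<bullet> \<eta> = 0) \<and>
         (\<forall>\<theta> \<in> angular_points t0 t1 xb \<union> {t1}.
            \<eta> \<bullet> (left_lim (Lbar_vv L t0 t1 xb) \<theta> *v \<eta>) = 0 \<longrightarrow>
            left_lim (grad_quad_Lbar_vv L t0 t1 xb \<eta>) \<theta> \<bullet> \<eta> = 0)"
proof -
  let ?T = "einterval a b"
  let ?U = "?T \<times> (UNIV :: (real^'n) set) \<times> (UNIV :: (real^'n) set)"
  let ?v = "velocity t0 t1 xb" and ?ang = "angular_points t0 t1 xb"
  have openU: "open ?U" by (intro open_Times open_einterval open_UNIV)
  obtain D :: "real \<times> (real^'n) \<times> (real^'n) \<Rightarrow> (real \<times> (real^'n) \<times> (real^'n)) \<Rightarrow>\<^sub>L real"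
    where D: "\<And>p. p \<in> ?U \<Longrightarrow> ((\<lambda>(t, x, v). L t x v) has_derivative blinfun_apply (D p)) (at p)"
    using assms(3) unfolding C1_total_def by blast
  have L: "continuous_on ?U (\<lambda>(t, x, v). L t x v)"
    using has_derivative_continuous[OF D] by (intro continuous_at_imp_continuous_on) blast
  obtain D1 :: "real \<times> (real^'n) \<times> (real^'n) \<Rightarrow> (real^'n) \<Rightarrow>\<^sub>L real"
    and D2 :: "real \<times> (real^'n) \<times> (real^'n) \<Rightarrow> (real^'n) \<Rightarrow>\<^sub>L (real^'n) \<Rightarrow>\<^sub>L real"
    and D3 :: "real \<times> (real^'n) \<times> (real^'n) \<Rightarrow> (real^'n) \<Rightarrow>\<^sub>L (real^'n) \<Rightarrow>\<^sub>L (real^'n) \<Rightarrow>\<^sub>L real"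
    where D23: "continuous_on ?U D2" "continuous_on ?U D3"
      and D': "\<forall>(t, x, v)\<in>?U.
           (L t x has_derivative blinfun_apply (D1 (t, x, v))) (at v) \<and>
           ((\<lambda>w. D1 (t, x, w)) has_derivative blinfun_apply (D2 (t, x, v))) (at v) \<and>
           ((\<lambda>w. D2 (t, x, w)) has_derivative blinfun_apply (D3 (t, x, v))) (at v)"
    using assms(4) unfolding C3_last_def by blast
  have d: "(L t x has_derivative blinfun_apply (D1 (t, x, v))) (at v)"
    "((\<lambda>w. D1 (t, x, w)) has_derivative blinfun_apply (D2 (t, x, v))) (at v)"
    "((\<lambda>w. D2 (t, x, w)) has_derivative blinfun_apply (D3 (t, x, v))) (at v)"
    if "t \<in> ?T" for t x v
    using bspec[OF D', of "(t, x, v)"] that by simp_all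
  have hess: "hessian (L t x) v = matrix (\<lambda>h. \<Sum>b\<in>Basis. D2 (t, x, v) h b *\<^sub>R b)"
    "\<eta> \<bullet> (hessian (L t x) v *v \<eta>) = D2 (t, x, v) \<eta> \<eta>" if "t \<in> ?T" for t x v
    using hessian_eq_matrix[of "L t x" "\<lambda>w. D1 (t, x, w)"] d[OF that] by blast+
  have grad: "gradient (\<lambda>v. \<eta> \<bullet> (hessian (L t x) v *v \<eta>)) v = (\<Sum>b\<in>Basis. D3 (t, x, v) b \<eta> \<eta> *\<^sub>R b)"
    if "t \<in> ?T" for t x v
    unfolding hess(2)[OF that]
    using gradient_eq_sum_Basis[OF bounded_linear.has_derivative[OF blinfun.bounded_linear_left
        bounded_linear.has_derivative[OF blinfun.bounded_linear_left d(3)[OF that]]]] .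
  obtain \<delta> where \<delta>: "\<delta> > 0" and min: "\<And>x. admissible t0 t1 x0 x1 x \<Longrightarrow>
        C_norm t0 t1 (\<lambda>t. x t - xb t) \<le> \<delta> \<Longrightarrow>
        Linf_norm t0 t1 (\<lambda>t. velocity t0 t1 x t - ?v t) \<le> ereal \<delta> \<Longrightarrow>
        J L t0 t1 xb \<le> J L t0 t1 x" and adm: "admissible t0 t1 x0 x1 xb"
    using assms(5) unfolding weak_local_minimum_def by auto
  have xb: "xb \<in> KC1 t0 t1" using adm by (simp add: admissible_def)
  \<comment> \<open>The velocity \<open>u\<close> is a free parameter because at an angular point it
    will be a one-sided limit instead of \<open>?v \<theta>\<close>.\<close>
  let ?good = "\<lambda>\<theta> u. \<forall>w. norm w \<le> \<delta> \<longrightarrow>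
    3 * L \<theta> (xb \<theta>) u \<le> L \<theta> (xb \<theta>) (u + w) + 2 * L \<theta> (xb \<theta>) (u - (1 / 2) *\<^sub>R w)"
  have needle: "?good p (?v p)" if "p \<in> {t0<..<t1} - ?ang" for p
    using needle_inequality[OF assms(1,2) open_einterval L adm \<delta> min that] by simp
  have cubic: "gradient (\<lambda>v. \<eta> \<bullet> (hessian (L \<theta> (xb \<theta>)) v *v \<eta>)) u \<bullet> \<eta> = 0"
    if T: "\<theta> \<in> ?T" and good: "?good \<theta> u" and "\<eta> \<bullet> (hessian (L \<theta> (xb \<theta>)) u *v \<eta>) = 0" for \<theta> u
  proof (rule cubic_term_zero[OF d(1)[OF T] d(2)[OF T] d(3)[OF T]])
    \<comment> \<open>The needle is taken with \<open>w = s *\<^sub>R \<eta>\<close>, so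
      \<open>norm w \<le> \<delta>\<close> turns into this bound on \<open>s\<close>.\<close>
    show "\<delta> / norm \<eta> > 0" using \<delta> assms(6) by simp
    show "3 * L \<theta> (xb \<theta>) u \<le> L \<theta> (xb \<theta>) (u + s *\<^sub>R \<eta>) + 2 * L \<theta> (xb \<theta>) (u - (s / 2) *\<^sub>R \<eta>)"
      if "\<bar>s\<bar> < \<delta> / norm \<eta>" for s
      using good[rule_format, of "s *\<^sub>R \<eta>"] that assms(6) by (simp add: field_simps)
  qed fact
  \<comment> \<open>\<open>F\<close> will be \<open>at_right \<theta>\<close> or
    \<open>at_left \<theta>\<close>. Along it the Hessian, the gradient and the needle inequality
    all pass to the limit velocity \<open>u\<close>, where \<open>cubic\<close> applies.\<close>
  have limit: "\<eta> \<bullet> (Lim F (Lbar_vv L t0 t1 xb) *v \<eta>) = 0 \<longrightarrow>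
      Lim F (grad_quad_Lbar_vv L t0 t1 xb \<eta>) \<bullet> \<eta> = 0"
    if F: "F \<noteq> bot" "F \<le> at \<theta> within {t0..t1}" and \<theta>: "\<theta> \<in> {t0..t1}"
      and lim: "\<exists>u. (?v \<longlongrightarrow> u) F" and int: "eventually (\<lambda>t. t \<in> {t0<..<t1}) F" for F \<theta>
  proof -
    obtain u where u: "(?v \<longlongrightarrow> u) F" using lim by blast
    have "(xb \<longlongrightarrow> xb \<theta>) (at \<theta> within {t0..t1})"
      using KC1_continuous_on[OF xb] \<theta> by (simp add: continuous_on_def)
    then have x: "(xb \<longlongrightarrow> xb \<theta>) F" using F(2) tendsto_mono by blast
    have id: "((\<lambda>t. t) \<longlongrightarrow> \<theta>) F" using F(2) tendsto_mono tendsto_ident_at by blast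
    have T: "\<theta> \<in> ?T" using \<theta> assms(2) by blast
    have evT: "eventually (\<lambda>t. t \<in> ?T) F"
      using int by eventually_elim (use assms(2) in auto)
    \<comment> \<open>The offset \<open>c\<close> lets one fact serve \<open>D2\<close> and
      \<open>D3\<close> as well as \<open>L\<close> at velocities shifted by \<open>w\<close> and
      \<open>-w/2\<close>.\<close>
    have conv: "((\<lambda>t. f (t, xb t, ?v t + c)) \<longlongrightarrow> f (\<theta>, xb \<theta>, u + c)) F"
      if "continuous_on ?U f" for f :: "real \<times> (real^'n) \<times> (real^'n) \<Rightarrow> 'z::topological_space" and c
    proof -
      have "isCont f (\<theta>, xb \<theta>, u + c)"
        using that T continuous_on_eq_continuous_at[OF openU] by auto
      moreover have "((\<lambda>t. (t, xb t, ?v t + c)) \<longlongrightarrow> (\<theta>, xb \<theta>, u + c)) F"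
        using id x u by (intro tendsto_intros)
      ultimately show ?thesis by (rule isCont_tendsto_compose)
    qed
    have D2: "((\<lambda>t. D2 (t, xb t, ?v t)) \<longlongrightarrow> D2 (\<theta>, xb \<theta>, u)) F"
      using conv[OF D23(1), of 0] by simp
    have D3: "((\<lambda>t. D3 (t, xb t, ?v t)) \<longlongrightarrow> D3 (\<theta>, xb \<theta>, u)) F"
      using conv[OF D23(2), of 0] by simp
    \<comment> \<open>Convergence is checked entrywise on the explicit formula, which is known to
      represent the Hessian for times in \<open>?T\<close>; hence the eventual equality
      below.\<close>
    have "((\<lambda>t. matrix (\<lambda>h. \<Sum>b\<in>Basis. D2 (t, xb t, ?v t) h b *\<^sub>R b)) \<longlongrightarrow>
        matrix (\<lambda>h. \<Sum>b\<in>Basis. D2 (\<theta>, xb \<theta>, u) h b *\<^sub>R b)) F"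
      unfolding matrix_def
      by (intro vec_tendstoI) (auto intro!: tendsto_intros D2)
    then have "((\<lambda>t. matrix (\<lambda>h. \<Sum>b\<in>Basis. D2 (t, xb t, ?v t) h b *\<^sub>R b)) \<longlongrightarrow>
        hessian (L \<theta> (xb \<theta>)) u) F"
      using hess(1)[OF T] by simp
    then have "(Lbar_vv L t0 t1 xb \<longlongrightarrow> hessian (L \<theta> (xb \<theta>)) u) F"
      by (rule Lim_transform_eventually) (use evT in \<open>eventually_elim, simp add: Lbar_vv_def hess(1)\<close>)
    then have 1: "Lim F (Lbar_vv L t0 t1 xb) = hessian (L \<theta> (xb \<theta>)) u"
      by (rule tendsto_Lim[OF F(1)])
    have "((\<lambda>t. \<Sum>b\<in>Basis. D3 (t, xb t, ?v t) b \<eta> \<eta> *\<^sub>R b) \<longlongrightarrow> (\<Sum>b\<in>Basis. D3 (\<theta>, xb \<theta>, u) b \<eta> \<eta> *\<^sub>R b)) F"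
      by (intro tendsto_intros D3)
    then have "((\<lambda>t. \<Sum>b\<in>Basis. D3 (t, xb t, ?v t) b \<eta> \<eta> *\<^sub>R b) \<longlongrightarrow>
        gradient (\<lambda>v. \<eta> \<bullet> (hessian (L \<theta> (xb \<theta>)) v *v \<eta>)) u) F"
      using grad[OF T] by simp
    then have "(grad_quad_Lbar_vv L t0 t1 xb \<eta> \<longlongrightarrow>
        gradient (\<lambda>v. \<eta> \<bullet> (hessian (L \<theta> (xb \<theta>)) v *v \<eta>)) u) F"
      by (rule Lim_transform_eventually) (use evT in \<open>eventually_elim, simp add: grad_quad_Lbar_vv_def grad\<close>)
    then have 2: "Lim F (grad_quad_Lbar_vv L t0 t1 xb \<eta>) =
        gradient (\<lambda>v. \<eta> \<bullet> (hessian (L \<theta> (xb \<theta>)) v *v \<eta>)) u"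
      by (rule tendsto_Lim[OF F(1)])
    \<comment> \<open>There are only finitely many angular points, so \<open>F\<close> eventually
      avoids them, and the needle inequality holds at the remaining interior times.\<close>
    have ev: "eventually (\<lambda>t. ?good t (?v t)) F"
      using int filter_leD[OF F(2) eventually_at_within_notin_finite[OF KC1_finite_angular[OF xb]]]
      by eventually_elim (use needle in blast)
    have "3 * L \<theta> (xb \<theta>) u \<le> L \<theta> (xb \<theta>) (u + w) + 2 * L \<theta> (xb \<theta>) (u - (1 / 2) *\<^sub>R w)"
      if w: "norm w \<le> \<delta>" for w
    proof (rule tendsto_le[OF F(1)])
      show "((\<lambda>t. L t (xb t) (?v t + w) + 2 * L t (xb t) (?v t - (1 / 2) *\<^sub>R w)) \<longlongrightarrow>
          L \<theta> (xb \<theta>) (u + w) + 2 * L \<theta> (xb \<theta>) (u - (1 / 2) *\<^sub>R w)) F"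
        using tendsto_add[OF conv[OF L, of w] tendsto_mult[OF tendsto_const[of 2]
            conv[OF L, of "- ((1/2) *\<^sub>R w)"]]] by simp
      show "((\<lambda>t. 3 * L t (xb t) (?v t)) \<longlongrightarrow> 3 * L \<theta> (xb \<theta>) u) F"
        using tendsto_mult[OF tendsto_const[of 3] conv[OF L, of 0]] by simp
      show "eventually (\<lambda>t. 3 * L t (xb t) (?v t) \<le>
          L t (xb t) (?v t + w) + 2 * L t (xb t) (?v t - (1 / 2) *\<^sub>R w)) F"
        using ev by eventually_elim (use w in blast)
    qed
    then show ?thesis unfolding 1 2 using cubic[OF T, of u] by blast
  qed
  have right: "\<eta> \<bullet> (right_lim (Lbar_vv L t0 t1 xb) \<theta> *v \<eta>) = 0 \<longrightarrow>
      right_lim (grad_quad_Lbar_vv L t0 t1 xb \<eta>) \<theta> \<bullet> \<eta> = 0" if \<theta>: "t0 \<le> \<theta>" "\<theta> < t1" for \<theta>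
    unfolding right_lim_def
  proof (rule limit)
    show "at_right \<theta> \<le> at \<theta> within {t0..t1}"
      unfolding at_within_Icc_at_right[OF \<theta>(2), symmetric] using \<theta>(1) by (intro at_le) auto
    show "eventually (\<lambda>t. t \<in> {t0<..<t1}) (at_right \<theta>)"
      using eventually_at_right_real[OF \<theta>(2)] by eventually_elim (use \<theta> in auto)
  qed (use \<theta> KC1_right_limit[OF xb \<theta>] in auto)
  have left: "\<eta> \<bullet> (left_lim (Lbar_vv L t0 t1 xb) \<theta> *v \<eta>) = 0 \<longrightarrow>
      left_lim (grad_quad_Lbar_vv L t0 t1 xb \<eta>) \<theta> \<bullet> \<eta> = 0" if \<theta>: "t0 < \<theta>" "\<theta> \<le> t1" for \<theta>
    unfolding left_lim_def
  proof (rule limit)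
    show "at_left \<theta> \<le> at \<theta> within {t0..t1}"
      unfolding at_within_Icc_at_left[OF \<theta>(1), symmetric] using \<theta>(2) by (intro at_le) auto
    show "eventually (\<lambda>t. t \<in> {t0<..<t1}) (at_left \<theta>)"
      using eventually_at_left_real[OF \<theta>(1)] by eventually_elim (use \<theta> in auto)
  qed (use \<theta> KC1_left_limit[OF xb \<theta>] in auto)
  have inner: "grad_quad_Lbar_vv L t0 t1 xb \<eta> \<theta> \<bullet> \<eta> = 0"
    if "\<theta> \<in> {t0<..<t1} - ?ang" "\<eta> \<bullet> (Lbar_vv L t0 t1 xb \<theta> *v \<eta>) = 0" for \<theta>
  proof -
    have "\<theta> \<in> {t0..t1}" using that(1) by simp
    then have "\<theta> \<in> ?T" using assms(2) by blast
    then show ?thesis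
      using cubic[OF _ needle[OF that(1)]] that(2)
      unfolding grad_quad_Lbar_vv_def Lbar_vv_def by blast
  qed
  show ?thesis
    using inner right left angular_points_subset[of t0 t1 xb] assms(1) by fastforce
qed

end
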